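(* Let $f$ be a hereditary graph parameter. Assume furthermore that there exists a function $g\colon\mathbb{N}^2\to\mathbb{N}$ such that $f(G)\le g(f(G[X]),f(G-X))$ for every graph $G$ and every set $X\subseteq V(G)$ (such that $f(G[X])$ and $f(G-X)$ are finite). Then for all integers $p$ and $s$, there exists an integer $p'$ such that $\mathrm{col}_{f,p'}(G)=1$ for every graph $G$ satisfying $\chi_{f,p}(G)\le s$.
   Context: Graphs are finite and simple. A graph parameter $f$ assigns to every graph an element of $\mathbb{N}\cup\{\infty\}$ (where $\mathbb{N}$ is the set of non-negative integers), isomorphic graphs receiving the same value. It is hereditary if $f(H)\le f(G)$ whenever $H$ is an induced subgraph of $G$. For an integer $p$, a coloring $\varphi$ of the vertices of $G$ (adjacent vertices may receive the same color) is $(f,p)$-proper if $f(G[\varphi^{-1}(c)])\le p$ for each color $c$ used by $\varphi$. $\chi_{f,p}(G)$ is the least number $s$ of colors in an $(f,p)$-proper coloring of $G$ (and $\infty$ if there is none). For a positive integer $s$, an $s$-island in a graph $G$ is a non-empty set $I\subseteq V(G)$ such that each vertex in $I$ has less than $s$ neighbors in $G$ not belonging to $I$. $\mathrm{col}_{f,p}(G)$ is the least positive integer $s$ such that every non-null induced subgraph $H$ of $G$ contains an $s$-island $I$ (of $H$) satisfying $f(H[I])\le p$ (and $\infty$ if no such $s$ exists). *)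

theory Defs
  imports
    "Graph_Theory.Digraph_Component"
    "Graph_Theory.Digraph_Isomorphism"
    "HOL-Library.Extended_Nat"
    "HOL-Library.Infinite_Typeclass"
begin

(* The locale graph describes finite simple undirected graphs (possibly null) as symmetric
   digraphs: an edge is a pair of opposite arcs between its ends.  Vertices and arcs are taken from
   infinite types, so that every finite simple graph has an isomorphic copy of type
   ('a,'b) pre_digraph.  Only values on arguments satisfying graph matter. *)

definition graph_parameter :: "(('a::infinite,'b::infinite) pre_digraph \<Rightarrow> enat) \<Rightarrow> bool" where
  "graph_parameter f \<longleftrightarrow>
     (\<forall>G H. graph G \<longrightarrow> graph H \<longrightarrow> digraph_iso G H \<longrightarrow> f G = f H)"

definition hereditary :: "(('a::infinite,'b::infinite) pre_digraph \<Rightarrow> enat) \<Rightarrow> bool" where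
  "hereditary f \<longleftrightarrow>
     (\<forall>G H. graph G \<longrightarrow> induced_subgraph H G \<longrightarrow> f H \<le> f G)"

(* The bounds p and s range over all integers, negative ones included. *)
definition enat_le_int :: "enat \<Rightarrow> int \<Rightarrow> bool" (infix "\<le>\<^sub>i" 50) where
  "x \<le>\<^sub>i k \<longleftrightarrow> (\<exists>n. x = enat n \<and> int n \<le> k)"

definition proper_coloring ::
  "(('a::infinite,'b::infinite) pre_digraph \<Rightarrow> enat) \<Rightarrow> int \<Rightarrow> ('a,'b) pre_digraph \<Rightarrow> ('a \<Rightarrow> nat) \<Rightarrow> bool" where
  "proper_coloring f p G \<phi> \<longleftrightarrow>
     (\<forall>c \<in> \<phi> ` verts G. f (G \<restriction> {v \<in> verts G. \<phi> v = c}) \<le>\<^sub>i p)"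

(* Inf of the empty set of enat is \<infinity>; likewise in col below. *)
definition chi ::
  "(('a::infinite,'b::infinite) pre_digraph \<Rightarrow> enat) \<Rightarrow> int \<Rightarrow> ('a,'b) pre_digraph \<Rightarrow> enat" where
  "chi f p G = Inf {enat (card (\<phi> ` verts G)) | \<phi>. proper_coloring f p G \<phi>}"

definition island :: "nat \<Rightarrow> ('a,'b) pre_digraph \<Rightarrow> 'a set \<Rightarrow> bool" where
  "island s G I \<longleftrightarrow> I \<noteq> {} \<and> I \<subseteq> verts G \<and>
     (\<forall>v \<in> I. card {u \<in> verts G - I. v \<rightarrow>\<^bsub>G\<^esub> u} < s)"

definition col ::
  "(('a::infinite,'b::infinite) pre_digraph \<Rightarrow> enat) \<Rightarrow> int \<Rightarrow> ('a,'b) pre_digraph \<Rightarrow> enat" where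
  "col f p G = Inf {enat s | s. 0 < s \<and>
     (\<forall>H. induced_subgraph H G \<and> verts H \<noteq> {} \<longrightarrow>
        (\<exists>I. island s H I \<and> f (H \<restriction> I) \<le>\<^sub>i p))}"

end

theory Submission
  imports Defs
begin

text \<open>
  Removing one color class \<open>X\<close> from an \<open>(f, p)\<close>-properly colored graph leaves a graph that is
  properly colored with one color less, while \<open>f\<close> is at most \<open>p\<close> on \<open>X\<close> itself. The combination
  function \<open>g\<close> turns the bounds for these two parts into one for the whole graph, so by induction
  on the number of colors \<open>f\<close> is bounded by a constant \<open>p'\<close> on all non-null graphs colored with at most \<open>s\<close>
  colors (lemma \<open>bounded_of_proper_coloring\<close>). Once \<open>f G \<le> p'\<close>, heredity gives \<open>f H \<le> p'\<close> for each
  induced subgraph \<open>H\<close>. The full vertex set of \<open>H\<close> is always a 1-island, because no vertex has a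
  neighbor outside of it; hence it is the required island, and \<open>col f p' G = 1\<close>.
\<close>

lemma induce_subgraph_twice:
  "A \<subseteq> B \<Longrightarrow> (G \<restriction> B) \<restriction> A = G \<restriction> A"
  by (auto simp: induce_subgraph_def)

lemma (in wf_digraph) induce_subgraph_all: "G \<restriction> verts G = G"
  using induced_subgraph_refl induce_eq_iff_induced by blast

lemma (in graph) graph_induce_subgraph:
  assumes "S \<subseteq> verts G"
  shows "graph (G \<restriction> S)"
proof -
  interpret H: wf_digraph "G \<restriction> S" ..
  have "symmetric (G \<restriction> S)"
    using induced_graph_imp_symmetric[OF sym_arcs] assms by blast
  then show ?thesis
    using assms finite_subset[OF assms finite_verts]
    by unfold_locales (auto simp: no_loops intro: no_multi_arcs)
qed

lemma enat_le_intD: "x \<le>\<^sub>i p \<Longrightarrow> x \<le> enat (nat p)"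
  by (auto simp: enat_le_int_def)

lemma enat_le_intI: "x \<le> enat n \<Longrightarrow> x \<le>\<^sub>i int n"
  by (cases x) (auto simp: enat_le_int_def)

lemma proper_coloring_remove_class:
  assumes "proper_coloring f p G \<phi>"
  shows "proper_coloring f p (G \<restriction> (verts G - {v \<in> verts G. \<phi> v = c})) \<phi>"
proof -
  let ?W = "verts G - {v \<in> verts G. \<phi> v = c}"
  have "f ((G \<restriction> ?W) \<restriction> {v \<in> ?W. \<phi> v = d}) \<le>\<^sub>i p" if "d \<in> \<phi> ` ?W" for d
  proof -
    have "{v \<in> ?W. \<phi> v = d} = {v \<in> verts G. \<phi> v = d}"
      using that by auto
    moreover have "(G \<restriction> ?W) \<restriction> {v \<in> ?W. \<phi> v = d} = G \<restriction> {v \<in> ?W. \<phi> v = d}"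
      by (rule induce_subgraph_twice) auto
    moreover have "d \<in> \<phi> ` verts G"
      using that by auto
    ultimately show ?thesis
      using assms unfolding proper_coloring_def by metis
  qed
  then show ?thesis
    by (simp add: proper_coloring_def)
qed

text \<open>
  The null graph is excluded since none of the hypotheses bounds \<open>f\<close> on it: it has no color class
  that properness could speak of. For the same reason the induction step treats a graph with a
  single color class separately, rather than splitting it into this class and the null graph.
\<close>
lemma bounded_of_proper_coloring:
  fixes f :: "('a::infinite, 'b::infinite) pre_digraph \<Rightarrow> enat" and g :: "nat \<Rightarrow> nat \<Rightarrow> nat"
  assumes g: "\<forall>G X a b. graph G \<longrightarrow> X \<subseteq> verts G \<longrightarrow> f (G \<restriction> X) = enat a \<longrightarrow>
                f (G \<restriction> (verts G - X)) = enat b \<longrightarrow> f G \<le> enat (g a b)"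
  shows "\<exists>B. \<forall>G \<phi>. graph G \<longrightarrow> verts G \<noteq> {} \<longrightarrow> proper_coloring f p G \<phi> \<longrightarrow>
           card (\<phi> ` verts G) \<le> n \<longrightarrow> f G \<le> enat B"
proof (induction n)
  case 0
  have "verts G = {}" if "graph G" "card (\<phi> ` verts G) \<le> 0"
    for G :: "('a, 'b) pre_digraph" and \<phi> :: "'a \<Rightarrow> nat"
  proof -
    interpret graph G by fact
    show ?thesis using that(2) by simp
  qed
  then show ?case by blast
next
  case (Suc n)
  then obtain B where B: "\<And>G \<phi>. graph G \<Longrightarrow> verts G \<noteq> {} \<Longrightarrow> proper_coloring f p G \<phi> \<Longrightarrow>
    card (\<phi> ` verts G) \<le> n \<Longrightarrow> f G \<le> enat B" by blast
  \<comment> \<open>The maximum runs over all values of both parts below their bounds, as \<open>g\<close> need not be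
    monotone; the number \<open>nat p\<close> is there for graphs with one color class.\<close>
  define M where "M = Max (insert (nat p) ((\<lambda>(a, b). g a b) ` ({..nat p} \<times> {..B})))"
  have p_le_M: "nat p \<le> M"
    unfolding M_def by (rule Max_ge) auto
  have g_le_M: "g a b \<le> M" if "a \<le> nat p" "b \<le> B" for a b
    unfolding M_def using that by (intro Max_ge) auto
  have "f G \<le> enat M"
    if G: "graph G" "verts G \<noteq> {}" and \<phi>: "proper_coloring f p G \<phi>"
      and card: "card (\<phi> ` verts G) \<le> Suc n" for G \<phi>
  proof -
    interpret graph G by fact
    obtain c where c: "c \<in> \<phi> ` verts G" using G(2) by blast
    define X where "X = {v \<in> verts G. \<phi> v = c}"
    have X: "X \<subseteq> verts G" by (auto simp: X_def)
    have fX: "f (G \<restriction> X) \<le> enat (nat p)"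
      using \<phi> c by (auto simp: proper_coloring_def X_def intro: enat_le_intD)
    show ?thesis
    proof (cases "verts G - X = {}")
      case True
      then have "G \<restriction> X = G" using X induce_subgraph_all by (metis Diff_eq_empty_iff subset_antisym)
      then show ?thesis using fX p_le_M by (simp add: order_trans)
    next
      case False
      have "\<phi> ` (verts G - X) = \<phi> ` verts G - {c}" by (auto simp: X_def)
      then have "card (\<phi> ` (verts G - X)) \<le> n"
        using c card by simp
      then have fY: "f (G \<restriction> (verts G - X)) \<le> enat B"
        using False proper_coloring_remove_class[OF \<phi>, of c, folded X_def]
        by (intro B graph_induce_subgraph) auto
      obtain a b where "f (G \<restriction> X) = enat a" "a \<le> nat p" "f (G \<restriction> (verts G - X)) = enat b" "b \<le> B"
        using fX fY by (metis enat_ile enat_ord_simps(1))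
      then show ?thesis
        using g[rule_format, OF G(1) X] g_le_M by (meson enat_ord_simps(1) order_trans)
    qed
  qed
  then show ?case by blast
qed

lemma proper_coloring_of_chi_le:
  assumes "chi f p G \<le>\<^sub>i s"
  obtains \<phi> where "proper_coloring f p G \<phi>" "card (\<phi> ` verts G) \<le> nat s"
proof -
  let ?S = "{enat (card (\<phi> ` verts G)) | \<phi>. proper_coloring f p G \<phi>}"
  have le: "Inf ?S \<le> enat (nat s)"
    using enat_le_intD[OF assms] by (simp add: chi_def)
  then have "?S \<noteq> {}"
    by (metis Inf_empty enat_ord_simps(5) infinity_ileE top_enat_def)
  then have "Inf ?S \<in> ?S"
    by (metis (no_types, lifting) Inf_enat_def LeastI ex_in_conv)
  then show ?thesis using le that by auto
qed

lemma verts_island: "verts H \<noteq> {} \<Longrightarrow> island 1 H (verts H)"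
  by (simp add: island_def)

text \<open>
  The bound is only assumed for non-null graphs. For the null graph, which has no non-null induced
  subgraph, every positive number satisfies the condition defining \<open>col\<close>.
\<close>
lemma col_eq_1:
  assumes "hereditary f" "graph G" and bound: "verts G \<noteq> {} \<Longrightarrow> f G \<le> enat n"
  shows "col f (int n) G = 1"
proof -
  interpret graph G by fact
  let ?P = "\<lambda>s. \<forall>H. induced_subgraph H G \<and> verts H \<noteq> {} \<longrightarrow>
        (\<exists>I. island s H I \<and> f (H \<restriction> I) \<le>\<^sub>i int n)"
  have "\<exists>I. island 1 H I \<and> f (H \<restriction> I) \<le>\<^sub>i int n"
    if H: "induced_subgraph H G" "verts H \<noteq> {}" for H
  proof -
    interpret H: wf_digraph H
      using H(1) by (auto simp: induced_subgraph_def subgraph_def)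
    have "verts G \<noteq> {}"
      using H by (auto simp: induced_subgraph_def subgraph_def)
    then have "f H \<le> enat n"
      using assms(1,2) H(1) bound unfolding hereditary_def by (meson order_trans)
    then show ?thesis
      using verts_island[OF H(2)] enat_le_intI H.induce_subgraph_all by metis
  qed
  then have "?P 1" by blast
  then have "col f (int n) G \<le> 1"
    unfolding col_def by (intro Inf_lower) (auto simp: one_enat_def)
  moreover have "1 \<le> col f (int n) G"
    unfolding col_def by (intro Inf_greatest) (auto simp: one_enat_def)
  ultimately show ?thesis by (rule antisym)
qed

theorem lemma4:
  fixes f :: "('a::infinite, 'b::infinite) pre_digraph \<Rightarrow> enat"
  assumes "graph_parameter f"
    and "hereditary f"
    and "\<exists>g :: nat \<Rightarrow> nat \<Rightarrow> nat. \<forall>G X a b.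
           graph G \<longrightarrow> X \<subseteq> verts G \<longrightarrow>
           f (G \<restriction> X) = enat a \<longrightarrow> f (G \<restriction> (verts G - X)) = enat b \<longrightarrow>
           f G \<le> enat (g a b)"
  shows "\<forall>p s :: int. \<exists>p' :: int. \<forall>G.
           graph G \<longrightarrow> chi f p G \<le>\<^sub>i s \<longrightarrow> col f p' G = 1"
proof (intro allI)
  fix p s :: int
  obtain g where "\<forall>G X a b. graph G \<longrightarrow> X \<subseteq> verts G \<longrightarrow> f (G \<restriction> X) = enat a \<longrightarrow>
      f (G \<restriction> (verts G - X)) = enat b \<longrightarrow> f G \<le> enat (g a b)"
    using assms(3) by blast
  from bounded_of_proper_coloring[OF this, of p "nat s"]
  obtain B where B: "\<And>G \<phi>. graph G \<Longrightarrow> verts G \<noteq> {} \<Longrightarrow> proper_coloring f p G \<phi> \<Longrightarrow>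
      card (\<phi> ` verts G) \<le> nat s \<Longrightarrow> f G \<le> enat B" by blast
  have "col f (int B) G = 1" if "graph G" "chi f p G \<le>\<^sub>i s" for G
    using that proper_coloring_of_chi_le[OF that(2)] B
    by (intro col_eq_1[OF assms(2)]) blast+
  then show "\<exists>p'. \<forall>G. graph G \<longrightarrow> chi f p G \<le>\<^sub>i s \<longrightarrow> col f p' G = 1" by blast
qed

end
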